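(* The SWAP gate is not in the orbit closure of any Pfaffian gate or Pfaffian cogate under the respective actions of $\mathrm{SL}(2,\mathbb{C})^4$. That is: (i) for every Pfaffian gate $P\in(\mathbb{C}^2)^{\otimes 4}$, the vector $|0000\rangle+|0101\rangle+|1010\rangle+|1111\rangle$ does not lie in the Zariski closure of the orbit $\mathrm{SL}(2,\mathbb{C})^4.P$; (ii) for every Pfaffian cogate $P\in((\mathbb{C}^2)^* )^{\otimes 4}$, the covector $\langle 0000|+\langle 0101|+\langle 1010|+\langle 1111|$ does not lie in the Zariski closure of the orbit $\mathrm{SL}(2,\mathbb{C})^4.P$.
   Context: Notation: $\{v_0,v_1\}$ is an orthonormal basis of $\mathbb{C}^2$ with dual basis $\{v_0^*,v_1^*\}$; $|i_1\cdots i_k\rangle=v_{i_1}\otimes\cdots\otimes v_{i_k}$ and $\langle i_1\cdots i_k|=v_{i_1}^*\otimes\cdots\otimes v_{i_k}^*$. For $I\subseteq[n]=\{1,\dots,n\}$, $|I\rangle=|\chi_I(1)\cdots\chi_I(n)\rangle$ where $\chi_I$ is the indicator function of $I$, and $\langle I|$ is defined likewise; $\overline I=[n]\setminus I$. For an $n\times n$ skew-symmetric complex matrix $M$ let $M_I$ be the principal submatrix with rows and columns in $I$, and put $$\mathrm{sPf}_n(M)=\sum_{I\subseteq[n]}\mathrm{Pf}(M_I)\,|I\rangle\in(\mathbb{C}^2)^{\otimes n},\qquad \mathrm{sPf}^\vee_n(M)=\sum_{I\subseteq[n]}\mathrm{Pf}(M_I)\,\langle\overline I|\in((\mathbb{C}^2)^*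 )^{\otimes n},$$ where $\mathrm{Pf}$ of the empty matrix is $1$ and $\mathrm{Pf}$ of an odd-size matrix is $0$. Let $\mathcal{P}_n$ and $\mathcal{P}_n^\vee$ be the images of $\mathrm{sPf}_n$ and $\mathrm{sPf}_n^\vee$ (elementary arity-$n$ gates and cogates). Actions: $(g_1,\dots,g_n)\in\mathrm{SL}(2,\mathbb{C})^n$ acts on $(\mathbb{C}^2)^{\otimes n}$ by $v\mapsto(g_1\otimes\cdots\otimes g_n)v$ and on $((\mathbb{C}^2)^* )^{\otimes n}$ by $\phi\mapsto\phi\circ(g_1^{-1}\otimes\cdots\otimes g_n^{-1})$. A tensor in $(\mathbb{C}^2)^{\otimes n}$ is a Pfaffian gate if it lies in the $\mathrm{SL}(2,\mathbb{C})^n$-orbit of some element of $\mathcal{P}_n$; a tensor in $((\mathbb{C}^2)^* )^{\otimes n}$ is a Pfaffian cogate if it lies in the $\mathrm{SL}(2,\mathbb{C})^n$-orbit of some element of $\mathcal{P}_n^\vee$. The SWAP gate is the map $v_i\otimes v_j\mapsto v_j\otimes v_i$ on $\mathbb{C}^2\otimes\mathbb{C}^2$; vectorized, it is $|0000\rangle+|0101\rangle+|1010\rangle+|1111\rangle\in(\mathbb{C}^2)^{\otimes4}$ or $\langle 0000|+\langle 0101|+\langle 1010|+\langle 1111|\in((\mathbb{C}^2)^* )^{\otimes4}$. *)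

theory Defs
  imports "HOL-Analysis.Analysis"
begin

text \<open>
  The index set \<open>[n] = {1, \<dots>, n}\<close> is rendered as a finite linearly ordered type \<open>'n\<close> with \<open>n\<close>
  elements.  For \<open>n = 4\<close> it is the numeral type \<open>4\<close>, whose elements in increasing order are
  \<open>0 < 1 < 2 < 3\<close>, so \<open>k \<in> [4]\<close> corresponds to \<open>k - 1\<close>.

  The space \<open>(\<complex>\<^sup>2)\<close> tensored \<open>n\<close> times is the coordinate space indexed by the bit strings \<open>2 ^ 'n\<close>
  (the elements of the numeral type \<open>2\<close> are \<open>0\<close> and \<open>1\<close>): a tensor is the column vector of its
  coordinates in the basis \<open>|i\<^sub>1 \<dots> i\<^sub>n>\<close>.  An element of the \<open>n\<close>-fold tensor power of the dual space is
  the row vector of its coordinates in the dual basis \<open><i\<^sub>1 \<dots> i\<^sub>n|\<close>.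
\<close>

type_synonym 'n tensor = "complex ^ (2 ^ 'n)"
type_synonym 'n cotensor = "complex ^ (2 ^ 'n)"

definition ket :: "2 ^ 'n \<Rightarrow> 'n::finite tensor" where
  "ket s = axis s 1"

definition bra :: "2 ^ 'n \<Rightarrow> 'n::finite cotensor" where
  "bra s = axis s 1"

text \<open>The bit string with entries \<open>i\<^sub>1, \<dots>, i\<^sub>n\<close>, listed in the order of the index type:
  \<open>card {j. j < k}\<close> is the zero-based position of \<open>k\<close>.\<close>

definition bits :: "2 list \<Rightarrow> 2 ^ 'n::{finite,linorder}" where
  "bits xs = (\<chi> k. xs ! card {j. j < k})"

definition chi_set :: "'n set \<Rightarrow> 2 ^ 'n::finite" where
  "chi_set I = (\<chi> k. if k \<in> I then 1 else 0)"

text \<open>The Pfaffian of the matrix \<open>(A i j)\<close> with \<open>i, j < m\<close>, by the Leibniz-type formula.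
  For \<open>m = 0\<close> it is \<open>1\<close>.\<close>

definition pfaffian :: "nat \<Rightarrow> (nat \<Rightarrow> nat \<Rightarrow> complex) \<Rightarrow> complex" where
  "pfaffian m A =
    (if odd m then 0
     else (\<Sum>p | p permutes {..<m}.
             of_int (sign p) * (\<Prod>i<m div 2. A (p (2 * i)) (p (2 * i + 1))))
          / (2 ^ (m div 2) * fact (m div 2)))"

definition principal_submatrix ::
  "complex ^ 'n::{finite,linorder} ^ 'n::{finite,linorder} \<Rightarrow> 'n::{finite,linorder} set \<Rightarrow> nat \<Rightarrow> nat \<Rightarrow> complex" where
  "principal_submatrix M I =
    (\<lambda>a b. M $ (sorted_list_of_set I ! a) $ (sorted_list_of_set I ! b))"

definition principal_pfaffian :: "complex ^ 'n::{finite,linorder} ^ 'n::{finite,linorder} \<Rightarrow> 'n::{finite,linorder} set \<Rightarrow> complex" where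
  "principal_pfaffian M I = pfaffian (card I) (principal_submatrix M I)"

definition skew_symmetric :: "complex ^ 'n::finite ^ 'n::finite \<Rightarrow> bool" where
  "skew_symmetric M \<longleftrightarrow> transpose M = - M"

definition sPf :: "complex ^ 'n::{finite,linorder} ^ 'n::{finite,linorder} \<Rightarrow> 'n::{finite,linorder} tensor" where
  "sPf M = (\<Sum>I\<in>UNIV. principal_pfaffian M I *s ket (chi_set I))"

definition sPf_dual :: "complex ^ 'n::{finite,linorder} ^ 'n::{finite,linorder} \<Rightarrow> 'n::{finite,linorder} cotensor" where
  "sPf_dual M = (\<Sum>I\<in>UNIV. principal_pfaffian M I *s bra (chi_set (- I)))"

definition elementary_gates :: "'n::{finite,linorder} tensor set" where
  "elementary_gates = sPf ` {M. skew_symmetric M}"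

definition elementary_cogates :: "'n::{finite,linorder} cotensor set" where
  "elementary_cogates = sPf_dual ` {M. skew_symmetric M}"

definition SL2 :: "(complex ^ 2 ^ 2) set" where
  "SL2 = {g. det g = 1}"

text \<open>The matrix of \<open>g\<^sub>1 \<otimes> \<dots> \<otimes> g\<^sub>n\<close>.\<close>

definition tensor_mat ::
  "('n \<Rightarrow> complex ^ 2 ^ 2) \<Rightarrow> complex ^ (2 ^ 'n) ^ (2 ^ 'n::finite)" where
  "tensor_mat g = (\<chi> i j. \<Prod>k\<in>UNIV. g k $ (i $ k) $ (j $ k))"

definition gate_action :: "('n \<Rightarrow> complex ^ 2 ^ 2) \<Rightarrow> 'n tensor \<Rightarrow> 'n::finite tensor" where
  "gate_action g v = tensor_mat g *v v"

text \<open>For a row vector, composition with a linear map is multiplication by its matrix from the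
  right.\<close>

definition cogate_action :: "('n \<Rightarrow> complex ^ 2 ^ 2) \<Rightarrow> 'n cotensor \<Rightarrow> 'n::finite cotensor" where
  "cogate_action g \<phi> = \<phi> v* tensor_mat (\<lambda>k. matrix_inv (g k))"

definition gate_orbit :: "'n tensor \<Rightarrow> 'n::finite tensor set" where
  "gate_orbit v = {gate_action g v | g. \<forall>k. g k \<in> SL2}"

definition cogate_orbit :: "'n cotensor \<Rightarrow> 'n::finite cotensor set" where
  "cogate_orbit \<phi> = {cogate_action g \<phi> | g. \<forall>k. g k \<in> SL2}"

definition pfaffian_gate :: "'n::{finite,linorder} tensor \<Rightarrow> bool" where
  "pfaffian_gate P \<longleftrightarrow> (\<exists>Q\<in>elementary_gates. P \<in> gate_orbit Q)"

definition pfaffian_cogate :: "'n::{finite,linorder} cotensor \<Rightarrow> bool" where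
  "pfaffian_cogate P \<longleftrightarrow> (\<exists>Q\<in>elementary_cogates. P \<in> cogate_orbit Q)"

text \<open>Polynomial functions on complex affine space, as the algebra generated by the coordinates.\<close>

inductive complex_poly_fun :: "(complex ^ 'i \<Rightarrow> complex) \<Rightarrow> bool" where
  const: "complex_poly_fun (\<lambda>v. c)"
| coord: "complex_poly_fun (\<lambda>v. v $ i)"
| add: "complex_poly_fun f \<Longrightarrow> complex_poly_fun g \<Longrightarrow> complex_poly_fun (\<lambda>v. f v + g v)"
| mult: "complex_poly_fun f \<Longrightarrow> complex_poly_fun g \<Longrightarrow> complex_poly_fun (\<lambda>v. f v * g v)"

definition zariski_closed :: "(complex ^ 'i) set \<Rightarrow> bool" where
  "zariski_closed Z \<longleftrightarrow>
    (\<exists>F. (\<forall>f\<in>F. complex_poly_fun f) \<and> Z = {v. \<forall>f\<in>F. f v = 0})"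

definition zariski_closure :: "(complex ^ 'i) set \<Rightarrow> (complex ^ 'i) set" where
  "zariski_closure S = zariski_closed hull S"

definition swap_gate :: "4 tensor" where
  "swap_gate = ket (bits [0,0,0,0]) + ket (bits [0,1,0,1])
             + ket (bits [1,0,1,0]) + ket (bits [1,1,1,1])"

definition swap_cogate :: "4 cotensor" where
  "swap_cogate = bra (bits [0,0,0,0]) + bra (bits [0,1,0,1])
               + bra (bits [1,0,1,0]) + bra (bits [1,1,1,1])"

end

theory Submission
  imports Defs
begin

text \<open>
  Flatten a tensor \<open>v\<close> of arity 4 to the \<open>4 \<times> 4\<close> matrix \<open>T\<close> with rows indexed by the factors \<open>1, 3\<close> and
  columns by the factors \<open>2, 4\<close>.  With \<open>K = J \<otimes> J\<close>, where \<open>J\<close> is the symplectic form preserved by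
  \<open>SL(2)\<close>, the matrix \<open>X = T K T\<^sup>t K\<close> changes by conjugation under \<open>SL(2)\<^sup>4\<close>, so
  \<open>8 tr X\<^sup>3 - 6 (tr X) (tr X\<^sup>2) + (tr X)\<^sup>3\<close> is an invariant polynomial of degree 6.  If the coordinates
  of odd weight vanish, \<open>X\<close> splits into two \<open>2 \<times> 2\<close> blocks, and the invariant is divisible by the
  difference of their traces.  For elementary gates and cogates this difference vanishes, being the
  expansion of the \<open>4 \<times> 4\<close> Pfaffian, whereas the invariant of SWAP is 192.
\<close>

section \<open>Explicit enumeration of the small index types and of bit strings\<close>

lemma UNIV_2': "(UNIV :: 2 set) = {0, 1}"
  by (auto simp: UNIV_2)

lemma sum_22: "sum f (UNIV :: (2 \<times> 2) set) = f (0, 0) + f (0, 1) + f (1, 0) + f (1, 1)"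
proof -
  have "sum f (UNIV :: (2 \<times> 2) set) = (\<Sum>i\<in>UNIV. \<Sum>j\<in>UNIV. f (i, j))"
    by (simp add: sum.cartesian_product)
  then show ?thesis by (simp add: UNIV_2' add.assoc)
qed

lemma UNIV_4': "(UNIV :: 4 set) = {0, 1, 2, 3}"
proof -
  have 4: "(4 :: 4) = 0" by simp
  show ?thesis unfolding UNIV_4 4 by blast
qed

lemma sum_4': "sum f (UNIV :: 4 set) = f 0 + f 1 + f 2 + f 3"
  unfolding UNIV_4' by (simp add: add.assoc)

lemma prod_4': "prod f (UNIV :: 4 set) = f 0 * f 1 * f 2 * f 3"
  unfolding UNIV_4' by (simp add: mult.assoc)

lemma forall_4': "(\<forall>k::4. P k) \<longleftrightarrow> P 0 \<and> P 1 \<and> P 2 \<and> P 3"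
proof -
  have "(4 :: 4) = 0" by simp
  then show ?thesis by (metis forall_4)
qed

lemma less_4: "(0::4) < 1" "(0::4) < 2" "(0::4) < 3" "(1::4) < 2" "(1::4) < 3" "(2::4) < 3"
  by (simp_all add: less_bit0_def bit0.Rep_0 bit0.Rep_1 bit0.Rep_numeral)

text \<open>The union is written in descending order so that simplification turns it into an
  ascending enumeration, the form that \<open>principal_pfaffian_pair\<close> and
  \<open>UNIV_4'\<close> match.\<close>

lemma Collect_4:
  "{k::4. P k} = (if P 3 then {3} else {}) \<union> ((if P 2 then {2} else {}) \<union>
    ((if P 1 then {1} else {}) \<union> (if P 0 then {0} else {})))"
proof -
  have "{k::4. P k} = {k \<in> {0, 1, 2, 3}. P k}"
    unfolding UNIV_4'[symmetric] by simp
  then show ?thesis by auto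
qed

lemma card_Collect_4: "card {k::4. P k} = (\<Sum>k\<in>UNIV. if P k then 1 else 0)"
  by (simp add: sum.If_cases)

lemma bits4_nth:
  "(bits [a, b, c, d] :: 2 ^ 4) $ 0 = a" "(bits [a, b, c, d] :: 2 ^ 4) $ 1 = b"
  "(bits [a, b, c, d] :: 2 ^ 4) $ 2 = c" "(bits [a, b, c, d] :: 2 ^ 4) $ 3 = d"
  unfolding bits_def vec_lambda_beta card_Collect_4 sum_4'
  by (simp_all add: less_4 less_not_sym[OF less_4(1)] less_not_sym[OF less_4(2)]
      less_not_sym[OF less_4(3)] less_not_sym[OF less_4(4)] less_not_sym[OF less_4(5)]
      less_not_sym[OF less_4(6)])

lemma bits4_eq: "bits [s $ 0, s $ 1, s $ 2, s $ 3] = (s :: 2 ^ 4)"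
  by (simp add: vec_eq_iff forall_4' bits4_nth)

lemma bits4_inject:
  "(bits [a, b, c, d] :: 2 ^ 4) = bits [a', b', c', d'] \<longleftrightarrow> a = a' \<and> b = b' \<and> c = c' \<and> d = d'"
  by (simp add: vec_eq_iff forall_4' bits4_nth)

section \<open>Kronecker products and the symplectic form\<close>

definition kron :: "complex ^ 2 ^ 2 \<Rightarrow> complex ^ 2 ^ 2 \<Rightarrow> complex ^ (2 \<times> 2) ^ (2 \<times> 2)" where
  "kron A B = (\<chi> p q. A $ fst p $ fst q * B $ snd p $ snd q)"

lemma kron_mult: "kron A B ** kron C D = kron (A ** C) (B ** D)"
  by (simp add: kron_def matrix_matrix_mult_def vec_eq_iff sum_product sum.cartesian_product
      case_prod_unfold ac_simps)

lemma transpose_kron: "transpose (kron A B) = kron (transpose A) (transpose B)"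
  by (simp add: kron_def transpose_def vec_eq_iff)

definition symp :: "complex ^ 2 ^ 2" where
  "symp = (\<chi> i j. if i = j then 0 else if i = 0 then 1 else - 1)"

definition sympK :: "complex ^ (2 \<times> 2) ^ (2 \<times> 2)" where
  "sympK = kron symp symp"

text \<open>\<open>symp\<close> squares to minus the identity, and the two signs cancel.\<close>

lemma sympK_square: "sympK ** sympK = mat 1"
  by (simp add: sympK_def kron_mult)
    (auto simp: kron_def symp_def matrix_matrix_mult_def vec_eq_iff mat_def sum_2 forall_2)

text \<open>For any 2 by 2 matrix the left-hand side is \<open>det g\<close> times
  \<open>symp\<close>.\<close>

lemma SL2_symp:
  assumes "g \<in> SL2" shows "transpose g ** symp ** g = symp"
  using assms
  by (auto simp: SL2_def det_2 symp_def transpose_def matrix_matrix_mult_def vec_eq_iff sum_2 forall_2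
      algebra_simps)

lemma kron_sympK:
  assumes "g \<in> SL2" "h \<in> SL2"
  shows "transpose (kron g h) ** sympK ** kron g h = sympK"
  using assms by (simp add: sympK_def transpose_kron kron_mult SL2_symp)

lemma SL2_transpose: "g \<in> SL2 \<Longrightarrow> transpose g \<in> SL2"
  by (simp add: SL2_def)

lemma SL2_matrix_inv:
  assumes "g \<in> SL2" shows "matrix_inv g \<in> SL2"
proof -
  have "invertible g" using assms by (simp add: SL2_def invertible_det_nz)
  then have "g ** matrix_inv g = mat 1"
    unfolding invertible_def matrix_inv_def by (rule someI2_ex) simp
  then have "det (g ** matrix_inv g) = 1"
    by simp
  then show ?thesis using assms by (simp add: SL2_def det_mul)
qed

section \<open>The flattened tensor and its Gram matrix\<close>

text \<open>The split 13|24 singles out the crossing matching, the one with a minus sign in the 4 by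
  4 Pfaffian.\<close>

definition flat13_24 :: "4 tensor \<Rightarrow> complex ^ (2 \<times> 2) ^ (2 \<times> 2)" where
  "flat13_24 v = (\<chi> p q. v $ bits [fst p, fst q, snd p, snd q])"

lemma flat_gate_action:
  "flat13_24 (gate_action g v) = kron (g 0) (g 2) ** flat13_24 v ** transpose (kron (g 1) (g 3))"
proof -
  \<comment> \<open>The order \<open>(q, p)\<close> follows the left-associated matrix product,
    whose outer sum runs over the columns \<open>q\<close> of the flattened tensor.\<close>
  define h :: "(2 \<times> 2) \<times> (2 \<times> 2) \<Rightarrow> 2 ^ 4"
    where "h = (\<lambda>(q, p). bits [fst p, fst q, snd p, snd q])"
  have h: "bij_betw h UNIV UNIV"
    by (rule bij_betw_byWitness[where f' = "\<lambda>s. ((s $ 1, s $ 3), (s $ 0, s $ 2))"])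
      (auto simp: h_def bits4_nth bits4_eq)
  have "flat13_24 (gate_action g v) $ (a, c) $ (b, d) =
      (kron (g 0) (g 2) ** flat13_24 v ** transpose (kron (g 1) (g 3))) $ (a, c) $ (b, d)" for a b c d
  proof -
    have "flat13_24 (gate_action g v) $ (a, c) $ (b, d) =
        (\<Sum>s\<in>UNIV. (\<Prod>k\<in>UNIV. g k $ (bits [a, b, c, d] $ k) $ (s $ k)) * v $ s)"
      by (simp add: flat13_24_def gate_action_def tensor_mat_def matrix_vector_mult_def)
    also have "\<dots> = (\<Sum>x\<in>UNIV. (\<Prod>k\<in>UNIV. g k $ (bits [a, b, c, d] $ k) $ (h x $ k)) * v $ h x)"
      by (rule sum.reindex_bij_betw[OF h, symmetric])
    also have "\<dots> = (\<Sum>q\<in>UNIV. \<Sum>p\<in>UNIV.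
        (\<Prod>k\<in>UNIV. g k $ (bits [a, b, c, d] $ k) $ (h (q, p) $ k)) * v $ h (q, p))"
      by (simp add: sum.cartesian_product)
    also have "\<dots> = (kron (g 0) (g 2) ** flat13_24 v ** transpose (kron (g 1) (g 3))) $ (a, c) $ (b, d)"
      by (simp add: matrix_matrix_mult_def kron_def flat13_24_def transpose_def h_def prod_4'
          bits4_nth sum_distrib_left sum_distrib_right ac_simps)
    finally show ?thesis .
  qed
  then show ?thesis by (simp add: vec_eq_iff)
qed

text \<open>The first three factors form the Gram matrix of the rows for the symmetric form
  \<open>sympK\<close>. The last factor turns this bilinear form into an endomorphism, so that a
  change of basis preserving \<open>sympK\<close> acts by conjugation.\<close>

definition gram :: "4 tensor \<Rightarrow> complex ^ (2 \<times> 2) ^ (2 \<times> 2)" where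
  "gram v = flat13_24 v ** sympK ** transpose (flat13_24 v) ** sympK"

text \<open>The column factor preserves \<open>sympK\<close> and drops out. The row factor
  \<open>A\<close> preserves it too, which makes \<open>sympK ** transpose A ** sympK\<close> its
  left inverse; inserting \<open>sympK ** sympK\<close> produces this matrix on the right.\<close>

lemma gram_gate_action:
  assumes "\<forall>k. g k \<in> SL2"
  obtains A B where "B ** A = mat 1" "gram (gate_action g v) = A ** gram v ** B"
proof
  let ?A = "kron (g 0) (g 2)" and ?T = "flat13_24 v" and ?C = "transpose (kron (g 1) (g 3))"
  let ?B = "sympK ** transpose ?A ** sympK"
  have "?B ** ?A = sympK ** (transpose ?A ** sympK ** ?A)"
    by (simp add: matrix_mul_assoc)
  also have "\<dots> = mat 1"
    using assms by (simp add: kron_sympK sympK_square)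
  finally show "?B ** ?A = mat 1" .
  have C: "?C ** sympK ** transpose ?C = sympK"
    using kron_sympK[of "g 1" "g 3"] assms by simp
  have "gram (gate_action g v) =
      ?A ** ?T ** (?C ** sympK ** transpose ?C) ** transpose ?T ** transpose ?A ** sympK"
    by (simp add: gram_def flat_gate_action matrix_transpose_mul matrix_mul_assoc)
  also have "\<dots> = ?A ** (?T ** sympK ** transpose ?T) ** mat 1 ** transpose ?A ** sympK"
    unfolding C by (simp add: matrix_mul_assoc)
  also have "\<dots> = ?A ** gram v ** ?B"
    unfolding sympK_square[symmetric] by (simp add: gram_def matrix_mul_assoc)
  finally show "gram (gate_action g v) = ?A ** gram v ** ?B" .
qed

section \<open>The sextic invariant and Zariski closures\<close>

text \<open>This is 8 times the trace of the cube of the traceless part of \<open>X\<close>. In the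
  eigenvalues a, b, c, d of \<open>X\<close> it equals 3 (a+b-c-d) (a+c-b-d) (a+d-b-c), hence the
  divisibility by the difference of the traces of two blocks.\<close>

definition sextic :: "4 tensor \<Rightarrow> complex" where
  "sextic v = (let X = gram v in
     8 * trace (X ** X ** X) - 6 * trace X * trace (X ** X) + trace X ^ 3)"

lemma sextic_gate_action:
  assumes "\<forall>k. g k \<in> SL2" shows "sextic (gate_action g v) = sextic v"
proof -
  let ?X = "gram v"
  obtain A B where BA: "B ** A = mat 1" and eq: "gram (gate_action g v) = A ** ?X ** B"
    by (rule gram_gate_action[OF assms])
  have tr: "trace (A ** Y ** B) = trace Y" for Y
  proof -
    have "trace (A ** Y ** B) = trace (B ** (A ** Y))" by (rule trace_mul_sym)
    also have "\<dots> = trace Y" by (simp add: matrix_mul_assoc BA)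
    finally show ?thesis .
  qed
  have mult: "A ** Y ** B ** (A ** Z ** B) = A ** (Y ** Z) ** B" for Y Z
  proof -
    have "A ** Y ** B ** (A ** Z ** B) = A ** Y ** (B ** A) ** Z ** B"
      by (simp add: matrix_mul_assoc)
    then show ?thesis by (simp add: BA matrix_mul_assoc)
  qed
  show ?thesis by (simp add: sextic_def Let_def eq mult tr)
qed

lemma complex_poly_fun_sum:
  "finite I \<Longrightarrow> (\<And>i. i \<in> I \<Longrightarrow> complex_poly_fun (f i)) \<Longrightarrow> complex_poly_fun (\<lambda>v. \<Sum>i\<in>I. f i v)"
proof (induction I rule: finite_induct)
  case empty
  then show ?case by (simp add: complex_poly_fun.const)
next
  case (insert i I)
  then have "complex_poly_fun (\<lambda>v. f i v + (\<Sum>i\<in>I. f i v))"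
    by (intro complex_poly_fun.add) simp_all
  then show ?case using insert.hyps by simp
qed

lemma complex_poly_fun_sextic: "complex_poly_fun sextic"
proof -
  have mult: "complex_poly_fun (\<lambda>v. (A v ** B v) $ i $ j)"
    if "\<And>i j. complex_poly_fun (\<lambda>v. A v $ i $ j)" "\<And>i j. complex_poly_fun (\<lambda>v. B v $ i $ j)"
    for A B :: "4 tensor \<Rightarrow> complex ^ (2 \<times> 2) ^ (2 \<times> 2)" and i j
    unfolding matrix_matrix_mult_def vec_lambda_beta
    by (rule complex_poly_fun_sum) (auto intro: complex_poly_fun.mult that)
  have flat: "complex_poly_fun (\<lambda>v. flat13_24 v $ i $ j)"
    "complex_poly_fun (\<lambda>v. transpose (flat13_24 v) $ i $ j)" for i j
    by (simp_all add: flat13_24_def transpose_def complex_poly_fun.coord)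
  have gram: "complex_poly_fun (\<lambda>v. gram v $ i $ j)" for i j
    unfolding gram_def by (rule mult flat complex_poly_fun.const)+
  have trace: "complex_poly_fun (\<lambda>v. trace (A v))"
    if "\<And>i j. complex_poly_fun (\<lambda>v. A v $ i $ j)" for A :: "4 tensor \<Rightarrow> complex ^ (2 \<times> 2) ^ (2 \<times> 2)"
    unfolding trace_def by (rule complex_poly_fun_sum) (auto intro: that)
  \<comment> \<open>The difference and the cube are spelled out by sums and products, to fit the
    introduction rules.\<close>
  have "complex_poly_fun (\<lambda>v. 8 * trace (gram v ** gram v ** gram v)
      + (- 6) * trace (gram v) * trace (gram v ** gram v)
      + trace (gram v) * trace (gram v) * trace (gram v))"
    by (rule gram mult trace complex_poly_fun.const complex_poly_fun.add complex_poly_fun.mult)+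
  then show ?thesis
    by (simp add: sextic_def[abs_def] Let_def power3_eq_cube)
qed

lemma sextic_orbit: "w \<in> gate_orbit v \<Longrightarrow> sextic w = sextic v"
  by (auto simp: gate_orbit_def sextic_gate_action)

text \<open>The zero set of \<open>sextic\<close> is closed and contains the whole orbit. A subset
  \<open>S\<close> is allowed so that cogate orbits are covered as well.\<close>

lemma sextic_zariski_closure:
  assumes "sextic v = 0" "S \<subseteq> gate_orbit v" "w \<in> zariski_closure S"
  shows "sextic w = 0"
proof -
  have "zariski_closed {w. sextic w = 0}"
    unfolding zariski_closed_def using complex_poly_fun_sextic
    by (intro exI[of _ "{sextic}"]) auto
  moreover have "S \<subseteq> {w. sextic w = 0}"
    using assms by (auto simp: sextic_orbit)
  ultimately show ?thesis
    using assms(3) hull_minimal unfolding zariski_closure_def by blast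
qed

section \<open>The invariant on tensors of even weight\<close>

lemma sextic_even:
  assumes "\<And>s. odd (card {k. s $ k = 1}) \<Longrightarrow> v $ s = 0"
  defines "t \<equiv> \<lambda>a b c d. v $ bits [a, b, c, d]"
  shows "sextic v = 96 *
    (t 0 0 0 0 * t 1 1 1 1 + t 0 1 0 1 * t 1 0 1 0 - t 0 0 1 1 * t 1 1 0 0 - t 0 1 1 0 * t 1 0 0 1) *
    (t 0 0 0 0 * t 1 1 1 1 * t 0 1 0 1 * t 1 0 1 0 - t 0 0 1 1 * t 1 1 0 0 * t 0 1 1 0 * t 1 0 0 1)"
proof -
  have flat: "flat13_24 v $ (a, c) $ (b, d) = t a b c d" for a b c d
    by (simp add: flat13_24_def t_def)
  have odd: "t 0 0 0 1 = 0" "t 0 0 1 0 = 0" "t 0 1 0 0 = 0" "t 1 0 0 0 = 0"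
    "t 1 1 1 0 = 0" "t 1 1 0 1 = 0" "t 1 0 1 1 = 0" "t 0 1 1 1 = 0"
    unfolding t_def
    by (rule assms(1); simp add: card_Collect_4 sum_4' bits4_nth)+
  \<comment> \<open>\<open>s\<close> and \<open>u\<close> are half the traces of the blocks of
    \<open>gram v\<close> on the indices (0,0), (1,1) and (0,1), (1,0).\<close>
  define s where "s = t 0 0 0 0 * t 1 1 1 1 + t 0 1 0 1 * t 1 0 1 0"
  define u where "u = t 0 0 1 1 * t 1 1 0 0 + t 0 1 1 0 * t 1 0 0 1"
  note K = sympK_def kron_def symp_def
  \<comment> \<open>Right multiplication by \<open>sympK\<close> only permutes columns and changes
    signs, so both halves of \<open>gram v\<close> have single-term entries.\<close>
  define Y where "Y = flat13_24 v ** sympK"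
  define Z where "Z = transpose (flat13_24 v) ** sympK"
  have Y: "Y $ p $ (0, 0) = flat13_24 v $ p $ (1, 1)" "Y $ p $ (1, 1) = flat13_24 v $ p $ (0, 0)"
    "Y $ p $ (0, 1) = - flat13_24 v $ p $ (1, 0)" "Y $ p $ (1, 0) = - flat13_24 v $ p $ (0, 1)" for p
    by (simp_all add: Y_def matrix_matrix_mult_def sum_22 K)
  have Z: "Z $ p $ (0, 0) = flat13_24 v $ (1, 1) $ p" "Z $ p $ (1, 1) = flat13_24 v $ (0, 0) $ p"
    "Z $ p $ (0, 1) = - flat13_24 v $ (1, 0) $ p" "Z $ p $ (1, 0) = - flat13_24 v $ (0, 1) $ p" for p
    by (simp_all add: Z_def matrix_matrix_mult_def sum_22 K transpose_def)
  define X where "X = gram v"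
  have gram: "X = Y ** Z"
    by (simp add: X_def gram_def Y_def Z_def matrix_mul_assoc)
  have X: "X $ (0, 0) $ (0, 0) = s" "X $ (1, 1) $ (1, 1) = s"
    "X $ (0, 0) $ (1, 1) = 2 * t 0 0 0 0 * t 0 1 0 1" "X $ (1, 1) $ (0, 0) = 2 * t 1 0 1 0 * t 1 1 1 1"
    "X $ (0, 1) $ (0, 1) = u" "X $ (1, 0) $ (1, 0) = u"
    "X $ (0, 1) $ (1, 0) = 2 * t 0 0 1 1 * t 0 1 1 0" "X $ (1, 0) $ (0, 1) = 2 * t 1 0 0 1 * t 1 1 0 0"
    "X $ (0, 0) $ (0, 1) = 0" "X $ (0, 0) $ (1, 0) = 0" "X $ (1, 1) $ (0, 1) = 0" "X $ (1, 1) $ (1, 0) = 0"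
    "X $ (0, 1) $ (0, 0) = 0" "X $ (0, 1) $ (1, 1) = 0" "X $ (1, 0) $ (0, 0) = 0" "X $ (1, 0) $ (1, 1) = 0"
    by (simp_all add: gram matrix_matrix_mult_def sum_22 Y Z flat odd s_def u_def)
  have "sextic v = 8 * trace (X ** X ** X) - 6 * trace X * trace (X ** X) + trace X ^ 3"
    by (simp add: sextic_def X_def Let_def)
  also have "\<dots> = 96 * (s - u) * (t 0 0 0 0 * t 1 1 1 1 * t 0 1 0 1 * t 1 0 1 0
      - t 0 0 1 1 * t 1 1 0 0 * t 0 1 1 0 * t 1 0 0 1)"
    unfolding trace_def matrix_matrix_mult_def vec_lambda_beta sum_22 X s_def u_def by algebra
  finally show ?thesis by (simp add: s_def u_def algebra_simps)
qed

section \<open>Pfaffians of sizes 2 and 4, and coordinates of elementary tensors\<close>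

text \<open>The Leibniz sum antisymmetrizes \<open>A\<close>.\<close>

lemma pfaffian_2: "pfaffian 2 A = (A 0 1 - A 1 0) / 2"
proof -
  have 2: "{..<2::nat} = {0, 1}" by auto
  have f: "finite {1::nat}" "0 \<notin> {1::nat}" by auto
  show ?thesis
    unfolding pfaffian_def 2 sum_over_permutations_insert[OF f] permutes_sing
    by (simp add: sign_swap_id permutation_swap_id sign_compose sign_id swap_id_eq lessThan_Suc)
qed

text \<open>The 24 permutations give three perfect matchings, each 8 times with the same signed
  product; the denominator \<open>2 ^ 2 * fact 2\<close> cancels the 8.\<close>

lemma pfaffian_4:
  assumes "\<And>i j. A j i = - A i j"
  shows "pfaffian 4 A = A 0 1 * A 2 3 - A 0 2 * A 1 3 + A 0 3 * A 1 2"
proof -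
  have 4: "{..<4::nat} = {0, 1, 2, 3}" by auto
  have 2: "{..<2::nat} = {0, 1}" by auto
  have f1: "finite {1::nat,2,3}" "0 \<notin> {1::nat,2,3}" by auto
  have f2: "finite {2::nat,3}" "1 \<notin> {2::nat,3}" by auto
  have f3: "finite {3::nat}" "2 \<notin> {3::nat}" by auto
  \<comment> \<open>Simplification rewrites the index 1 to \<open>Suc 0\<close>, so both forms are
    listed.\<close>
  have A: "A 1 0 = - A 0 1" "A 2 0 = - A 0 2" "A 3 0 = - A 0 3" "A 2 1 = - A 1 2"
    "A 3 1 = - A 1 3" "A 3 2 = - A 2 3" "A (Suc 0) 0 = - A 0 1" "A 2 (Suc 0) = - A 1 2" "A 3 (Suc 0) = - A 1 3"
    by (subst assms, simp)+
  show ?thesis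
    unfolding pfaffian_def 4 sum_over_permutations_insert[OF f1]
      sum_over_permutations_insert[OF f2] sum_over_permutations_insert[OF f3] permutes_sing
    by (simp add: sign_swap_id permutation_swap_id sign_compose sign_id swap_id_eq 2 A fact_numeral
        permutation_compose)
qed

text \<open>Solving for \<open>I\<close> lets the sum over all subsets in \<open>sPf\<close>
  collapse to one term.\<close>

lemma eq_chi_set_iff: "s = chi_set I \<longleftrightarrow> I = {k. s $ k = 1}"
proof -
  have "s $ k = 0 \<or> s $ k = 1" for k
    using exhaust_2[of "s $ k"] by auto
  then show ?thesis by (auto simp: chi_set_def vec_eq_iff) (metis zero_neq_one)
qed

lemma sPf_nth: "sPf M $ s = principal_pfaffian M {k. s $ k = 1}"
  by (simp add: sPf_def ket_def axis_def eq_chi_set_iff if_distrib[of "\<lambda>x. _ * x"] cong: if_cong)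

lemma sPf_dual_nth: "sPf_dual M $ s = principal_pfaffian M {k. s $ k \<noteq> 1}"
proof -
  have "s = chi_set (- I) \<longleftrightarrow> I = {k. s $ k \<noteq> 1}" for I
    by (auto simp: eq_chi_set_iff)
  then show ?thesis
    by (simp add: sPf_dual_def bra_def axis_def if_distrib[of "\<lambda>x. _ * x"] cong: if_cong)
qed

lemma principal_pfaffian_odd: "odd (card I) \<Longrightarrow> principal_pfaffian M I = 0"
  by (simp add: principal_pfaffian_def pfaffian_def)

lemma principal_pfaffian_empty: "principal_pfaffian M {} = 1"
  by (simp add: principal_pfaffian_def pfaffian_def)

lemma skew_symmetric_nth:
  assumes "skew_symmetric M" shows "M $ j $ i = - M $ i $ j"
proof -
  have "transpose M $ i $ j = (- M) $ i $ j"
    using assms by (simp add: skew_symmetric_def)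
  then show ?thesis by (simp add: transpose_def)
qed

lemma principal_pfaffian_pair:
  assumes "skew_symmetric M" "i < j"
  shows "principal_pfaffian M {i, j} = M $ i $ j"
proof -
  have list: "sorted_list_of_set {i, j} = [i, j]" and card: "card {i, j} = 2"
    using sorted_list_of_set.idem_if_sorted_distinct[of "[i, j]"] assms(2)
    by (simp_all add: less_imp_le less_imp_neq)
  show ?thesis
    unfolding principal_pfaffian_def card pfaffian_2 principal_submatrix_def list
    using skew_symmetric_nth[OF assms(1), of j i] by simp
qed

lemma principal_pfaffian_UNIV_4:
  fixes M :: "complex ^ 4 ^ 4"
  assumes "skew_symmetric M"
  shows "principal_pfaffian M UNIV =
    M $ 0 $ 1 * M $ 2 $ 3 - M $ 0 $ 2 * M $ 1 $ 3 + M $ 0 $ 3 * M $ 1 $ 2"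
proof -
  let ?xs = "[0, 1, 2, 3] :: 4 list"
  have "sorted ?xs" "distinct ?xs"
    using less_4 by (auto intro: less_imp_le)
  then have list: "sorted_list_of_set UNIV = ?xs"
    unfolding UNIV_4' using sorted_list_of_set.idem_if_sorted_distinct[of ?xs] by simp
  have "principal_submatrix M UNIV j i = - principal_submatrix M UNIV i j" for i j
    unfolding principal_submatrix_def by (rule skew_symmetric_nth[OF assms])
  from pfaffian_4[of "principal_submatrix M UNIV", OF this] show ?thesis
    unfolding principal_pfaffian_def
    by (simp add: principal_submatrix_def list)
qed

section \<open>Values of the invariant on elementary tensors and on SWAP\<close>

text \<open>In the first factor of \<open>sextic_even\<close>, the coordinate at 1111 is the full
  Pfaffian, and the other three products are its matching terms with opposite signs.\<close>

lemma sextic_elementary_gate: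
  assumes "skew_symmetric M" shows "sextic (sPf M) = 0"
proof -
  have even: "sPf M $ s = 0" if "odd (card {k. s $ k = 1})" for s
    using that by (simp add: sPf_nth principal_pfaffian_odd)
  show ?thesis
    by (subst sextic_even, erule even)
      (simp add: sPf_nth Collect_4 bits4_nth principal_pfaffian_empty
        principal_pfaffian_pair[OF assms] less_4
        principal_pfaffian_UNIV_4[OF assms, unfolded UNIV_4'])
qed

text \<open>Complementing bit strings preserves parity, as 4 is even, and exchanges the two
  coordinates in each product of the first factor, so the same cancellation occurs.\<close>

lemma sextic_elementary_cogate:
  assumes "skew_symmetric M" shows "sextic (sPf_dual M) = 0"
proof -
  have even: "sPf_dual M $ s = 0" if "odd (card {k. s $ k = 1})" for s
  proof -
    have "card {k. s $ k = 1} + card (- {k. s $ k = 1}) = 4"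
      using card_Un_disjoint[of "{k. s $ k = 1}" "- {k. s $ k = 1}"] by simp
    then have "odd (card (- {k. s $ k = 1}))"
      using that by presburger
    then show ?thesis by (simp add: sPf_dual_nth principal_pfaffian_odd Collect_neg_eq)
  qed
  show ?thesis
    by (subst sextic_even, erule even)
      (simp add: sPf_dual_nth Collect_4 bits4_nth principal_pfaffian_empty
        principal_pfaffian_pair[OF assms] less_4
        principal_pfaffian_UNIV_4[OF assms, unfolded UNIV_4'])
qed

text \<open>The surviving coordinates give 96 * 2 * 1.\<close>

lemma sextic_swap_gate: "sextic swap_gate = 192"
proof -
  have "swap_gate $ s = 0" if "odd (card {k. s $ k = 1})" for s
    using that by (auto simp: swap_gate_def ket_def axis_def card_Collect_4 sum_4' bits4_nth)
  then show ?thesis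
    by (subst sextic_even) (simp_all add: swap_gate_def ket_def axis_def bits4_inject)
qed

lemma swap_cogate_eq: "swap_cogate = swap_gate"
  by (simp add: swap_cogate_def swap_gate_def bra_def ket_def)

text \<open>Acting on row vectors from the right is acting on columns by the transpose, so the
  invariant for gates also serves cogates.\<close>

lemma cogate_action_eq:
  "cogate_action g \<phi> = gate_action (\<lambda>k. transpose (matrix_inv (g k))) \<phi>"
proof -
  have "tensor_mat (\<lambda>k. transpose (h k)) = transpose (tensor_mat h)" for h :: "'a \<Rightarrow> complex ^ 2 ^ 2"
    by (simp add: tensor_mat_def transpose_def vec_eq_iff)
  then show ?thesis by (simp add: cogate_action_def gate_action_def)
qed

lemma cogate_orbit_subset: "cogate_orbit \<phi> \<subseteq> gate_orbit \<phi>"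
  by (fastforce simp: cogate_orbit_def gate_orbit_def cogate_action_eq
      intro: SL2_transpose SL2_matrix_inv)

theorem theorem3p4:
  shows "(\<forall>P :: 4 tensor. pfaffian_gate P \<longrightarrow> swap_gate \<notin> zariski_closure (gate_orbit P)) \<and>
         (\<forall>P :: 4 cotensor. pfaffian_cogate P \<longrightarrow> swap_cogate \<notin> zariski_closure (cogate_orbit P))"
proof (intro conjI allI impI notI)
  fix P :: "4 tensor"
  assume "pfaffian_gate P" and swap: "swap_gate \<in> zariski_closure (gate_orbit P)"
  then have "sextic P = 0"
    by (auto simp: pfaffian_gate_def elementary_gates_def sextic_orbit sextic_elementary_gate)
  then show False
    using sextic_zariski_closure[OF _ order_refl swap] by (simp add: sextic_swap_gate)
next
  fix P :: "4 cotensor"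
  assume "pfaffian_cogate P" and swap: "swap_cogate \<in> zariski_closure (cogate_orbit P)"
  then obtain Q where "Q \<in> elementary_cogates" "P \<in> gate_orbit Q"
    using cogate_orbit_subset by (auto simp: pfaffian_cogate_def)
  then have "sextic P = 0"
    by (auto simp: elementary_cogates_def sextic_orbit sextic_elementary_cogate)
  then show False
    using sextic_zariski_closure[OF _ cogate_orbit_subset swap]
    by (simp add: swap_cogate_eq sextic_swap_gate)
qed

end
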